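(* Let $D$ be a positive digraph with at least one edge. Then $\mathcal{P}_D$ is an integral polytope of dimension $q-2n+b$, where $q$ is the number of edges of $D$, $n$ is the number of vertices of $D$, and $b$ is the number of connected components of $G_D$ that are bipartite. The $d$-dimensional faces of $\mathcal{P}_D$ are the $d$-dimensional polytopes of magic labelings of positive subdigraphs of $D$ with $n$ vertices and at most $2n-b+d$ edges.
   Context: Digraphs are finite, loops are allowed, and there is at most one edge $e_{ij}$ from vertex $v_i$ to vertex $v_j$ for each ordered pair $(i,j)$. A magic labeling of a digraph $D$ of magic sum $r$ assigns a nonnegative integer to each edge so that for each vertex $v_i$ the labels of all edges with initial vertex $v_i$ sum to $r$ and the labels of all edges with terminal vertex $v_i$ sum to $r$. For $D$ with vertices $v_1,\dots,v_n$, $G_D$ is the bipartite graph with $2n$ vertices $a_1,\dots,a_n,b_1,\dots,b_n$ having an edge between $a_i$ and $b_j$ if and only if $e_{ij}$ is an edge of $D$. A (undirected) graph $G$ is positive if for every edge $e$ there is an assignment $L$ of nonnegative integers to the edges of $G$ with all vertex sums equal and $L(e)>0$. $D$ is positive if $G_D$ is positive. The polytope of magic labelings $\mathcal{P}_D\subseteq\mathbb{R}^q$ is the set of nonnegative real labelings of the edges of $D$ such that at every vertex the labels of the outgoing edges sum to $1$ and the labels of the incoming edges sum to $1$. A polytope is integral if all its vertices have integer coordinates. Faces are nonempty. For a subdigraph $D'$ of $D$ with the same vertex set, $\mathcal{P}_{D'}$ is viewed inside $\mathcal{P}_D$ by labeling the edges of $D$ not in $D'$ by $0$. *)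

theory Defs
  imports "HOL-Analysis.Analysis" "Graph_Theory.Digraph_Component"
begin

text \<open>
  A digraph with loops but without parallel arcs is a \<^typ>\<open>('v, 'e) pre_digraph\<close> satisfying
  \<^const>\<open>fin_digraph\<close> and \<^const>\<open>nomulti_digraph\<close>. An undirected graph has vertex set
  \<open>uverts\<close>, and its edges are the sets \<open>{u, v}\<close> in \<open>uedges\<close> (so that a loop is a singleton
  and counts once in a vertex sum).
\<close>

record 'w ugraph =
  uverts :: "'w set"
  uedges :: "'w set set"

definition magic_labeling_graph :: "'w ugraph \<Rightarrow> nat \<Rightarrow> ('w set \<Rightarrow> nat) \<Rightarrow> bool" where
  "magic_labeling_graph G r L \<longleftrightarrow> (\<forall>v\<in>uverts G. (\<Sum>e\<in>{e\<in>uedges G. v \<in> e}. L e) = r)"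

definition positive_graph :: "'w ugraph \<Rightarrow> bool" where
  "positive_graph G \<longleftrightarrow> (\<forall>e\<in>uedges G. \<exists>r L. magic_labeling_graph G r L \<and> L e > 0)"

definition connected_components_graph :: "'w ugraph \<Rightarrow> 'w set set" where
  "connected_components_graph G =
     uverts G // {(u, v). u \<in> uverts G \<and> v \<in> uverts G \<and> (u, v) \<in> {(x, y). {x, y} \<in> uedges G}\<^sup>*}"

definition bipartite_on :: "'w ugraph \<Rightarrow> 'w set \<Rightarrow> bool" where
  "bipartite_on G C \<longleftrightarrow> (\<exists>A B. A \<union> B = C \<and> A \<inter> B = {} \<and>
     (\<forall>u\<in>C. \<forall>v\<in>C. {u, v} \<in> uedges G \<longrightarrow> u \<in> A \<and> v \<in> B \<or> u \<in> B \<and> v \<in> A))"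

definition num_bipartite_components :: "'w ugraph \<Rightarrow> nat" where
  "num_bipartite_components G = card {C \<in> connected_components_graph G. bipartite_on G C}"

text \<open>The bipartite graph of a digraph; \<open>Inl v\<close> and \<open>Inr v\<close> are the two copies of the vertex \<open>v\<close>.\<close>

definition digraph_bipartite :: "('v, 'e) pre_digraph \<Rightarrow> ('v + 'v) ugraph" where
  "digraph_bipartite D =
     \<lparr> uverts = verts D <+> verts D,
       uedges = {{Inl u, Inr v} | u v. (u, v) \<in> arcs_ends D} \<rparr>"

definition positive_digraph :: "('v, 'e) pre_digraph \<Rightarrow> bool" where
  "positive_digraph D \<longleftrightarrow> positive_graph (digraph_bipartite D)"

text \<open>
  Labelings are vectors indexed by the type of arcs, with value 0 outside \<^term>\<open>arcs D\<close>. The ambient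
  space is thus exactly the space of labelings of the arcs if \<^term>\<open>arcs D = UNIV\<close>, and the polytope
  of a subdigraph lies in that of the whole digraph without any further embedding.
\<close>

definition magic_polytope :: "('v, 'e::finite) pre_digraph \<Rightarrow> (real ^ 'e) set" where
  "magic_polytope D = {x.
     (\<forall>e\<in>arcs D. 0 \<le> x $ e) \<and>
     (\<forall>e. e \<notin> arcs D \<longrightarrow> x $ e = 0) \<and>
     (\<forall>v\<in>verts D. (\<Sum>e\<in>out_arcs D v. x $ e) = 1 \<and> (\<Sum>e\<in>in_arcs D v. x $ e) = 1)}"

definition integral_polytope :: "(real ^ 'e::finite) set \<Rightarrow> bool" where
  "integral_polytope P \<longleftrightarrow> polytope P \<and> (\<forall>x. x extreme_point_of P \<longrightarrow> (\<forall>i. x $ i \<in> \<int>))"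

end

theory Submission
  imports Defs
begin

text \<open>
  The polytope is cut out of the nonnegative orthant by one equation per vertex of the bipartite
  graph. A linear dependency among these \<open>2n\<close> equations, after a sign change on one side of the
  bipartition, is a function that is constant on connected components; hence they have rank
  \<open>2n - b\<close>, which gives the dimension as soon as some point is positive on all arcs.

  If a point has non-integral coordinates, then every vertex meeting the set of non-integral arcs
  meets it at least twice, so there are at most as many such vertices as arcs. Their equations being
  dependent, some nonzero vector on these arcs has all vertex sums zero; moving along it in both
  directions shows that the point is not extreme.

  A nonempty face is the polytope of its support. That subdigraph is positive since the extreme
  points of the face are integral, and it has at least as many components as \<open>D\<close>, so the
  dimension formula bounds its number of arcs.
\<close>

section \<open>Linear algebra and counting preliminaries\<close>

text \<open>Stated for an indexed family because cardinalities of images are needed too: a collision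
  \<open>f i = f j\<close> is itself a relation, with coefficients 1 and -1.\<close>

lemma indexed_independent:
  fixes f :: "'a \<Rightarrow> 'b::real_vector"
  assumes fin: "finite I"
    and zero: "\<And>c i. (\<Sum>i\<in>I. c i *\<^sub>R f i) = 0 \<Longrightarrow> i \<in> I \<Longrightarrow> c i = 0"
  shows "inj_on f I" "independent (f ` I)"
proof -
  show inj: "inj_on f I"
  proof (rule inj_onI, rule ccontr)
    fix i j assume ij: "i \<in> I" "j \<in> I" "f i = f j" "i \<noteq> j"
    let ?c = "\<lambda>k. of_bool (k = i) - of_bool (k = j) :: real"
    have "(\<Sum>k\<in>I. ?c k *\<^sub>R f k) = (\<Sum>k\<in>I. if k = i then f i else 0) - (\<Sum>k\<in>I. if k = j then f j else 0)"
      unfolding sum_subtractf[symmetric] by (rule sum.cong) (auto simp: algebra_simps)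
    also have "\<dots> = 0" using ij fin by simp
    finally have "?c i = 0" by (rule zero) (fact ij(1))
    with ij(4) show False by simp
  qed
  show "independent (f ` I)"
  proof (rule independent_if_scalars_zero)
    fix c x assume "(\<Sum>x\<in>f ` I. c x *\<^sub>R x) = 0" and x: "x \<in> f ` I"
    then have "(\<Sum>i\<in>I. c (f i) *\<^sub>R f i) = 0" by (simp add: sum.reindex[OF inj])
    from zero[OF this] x show "c x = 0" by blast
  qed (use fin in simp)
qed

text \<open>Double counting over the fibres of \<open>f\<close>, each of which has at least two
  elements. It is applied to the tails and the heads of the arcs with non-integral label.\<close>

lemma card_image_two_to_one:
  assumes "finite F" and two: "\<And>e. e \<in> F \<Longrightarrow> \<exists>e'\<in>F. e' \<noteq> e \<and> f e' = f e"
  shows "2 * card (f ` F) \<le> card F"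
proof -
  have "2 \<le> card {e. e \<in> F \<and> f e = v}" if "v \<in> f ` F" for v
  proof -
    from that obtain e where e: "e \<in> F" "f e = v" by blast
    with two obtain e' where e': "e' \<in> F" "e' \<noteq> e" "f e' = v" by metis
    have "card {e, e'} \<le> card {e. e \<in> F \<and> f e = v}"
      using e e' assms(1) by (intro card_mono) auto
    with e'(2) show ?thesis by simp
  qed
  then have "(\<Sum>v\<in>f ` F. 2) \<le> (\<Sum>v\<in>f ` F. card {e. e \<in> F \<and> f e = v})"
    by (rule sum_mono)
  also have "\<dots> = card F"
    using sum.image_gen[OF assms(1), of "\<lambda>_. 1::nat" f] by simp
  finally show ?thesis by simp
qed

lemma dim_vec_supported:
  fixes A :: "'e::finite set"
  shows "dim {x :: real ^ 'e. \<forall>e. e \<notin> A \<longrightarrow> x $ e = 0} = card A"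
proof -
  let ?d = "(\<lambda>e. axis e (1::real)) ` A"
  have inj: "inj_on (\<lambda>e. axis e (1::real)) A" by (auto simp: inj_on_def axis_eq_axis)
  have "{x :: real ^ 'e. \<forall>e. e \<notin> A \<longrightarrow> x $ e = 0} = {x. \<forall>i\<in>Basis. i \<notin> ?d \<longrightarrow> x \<bullet> i = 0}"
    by (force simp: Basis_vec_def inner_axis axis_eq_axis)
  then show ?thesis
    using dim_substandard[of ?d] card_image[OF inj] by (force simp: Basis_vec_def)
qed

section \<open>Incidence vectors and the homogeneous vertex equations\<close>

text \<open>The coefficient vector of the vertex equation at \<open>w\<close>, a row of the
  incidence matrix of the bipartite graph: \<open>Inl\<close> copies govern outgoing arcs,
  \<open>Inr\<close> copies incoming ones. A loop thus enters two different rows.\<close>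

definition incidence :: "('v, 'e::finite) pre_digraph \<Rightarrow> 'v + 'v \<Rightarrow> real ^ 'e" where
  "incidence D w = (\<chi> e. of_bool (e \<in> arcs D \<and> (w = Inl (tail D e) \<or> w = Inr (head D e))))"

abbreviation bverts :: "('v, 'e) pre_digraph \<Rightarrow> ('v + 'v) set" where
  "bverts D \<equiv> verts D <+> verts D"

text \<open>For \<open>W = bverts D\<close> these are the directions along which the polytope can
  extend. Integrality needs the version with fewer equations.\<close>

definition magic_kernel :: "('v, 'e::finite) pre_digraph \<Rightarrow> ('v + 'v) set \<Rightarrow> (real ^ 'e) set" where
  "magic_kernel D W = {y. (\<forall>e. e \<notin> arcs D \<longrightarrow> y $ e = 0) \<and> (\<forall>w\<in>W. incidence D w \<bullet> y = 0)}"

text \<open>The sign change on one side of the bipartition that turns linear relations among the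
  rows into functions constant along edges.\<close>

definition side_sign :: "'v + 'v \<Rightarrow> real" where
  "side_sign w = (case w of Inl _ \<Rightarrow> 1 | Inr _ \<Rightarrow> -1)"

lemma side_sign_simps [simp]: "side_sign (Inl v) = 1" "side_sign (Inr v) = -1"
  and side_sign_nz [simp]: "side_sign w \<noteq> 0"
  by (auto simp: side_sign_def split: sum.split)

lemma inner_incidence_Inl: "incidence D (Inl v) \<bullet> x = (\<Sum>e\<in>out_arcs D v. x $ e)"
  unfolding incidence_def inner_vec_def out_arcs_def
  by (rule sum.mono_neutral_cong_right) auto

lemma inner_incidence_Inr: "incidence D (Inr v) \<bullet> x = (\<Sum>e\<in>in_arcs D v. x $ e)"
  unfolding incidence_def inner_vec_def in_arcs_def
  by (rule sum.mono_neutral_cong_right) auto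

lemma mem_magic_polytope:
  "x \<in> magic_polytope D \<longleftrightarrow> (\<forall>e. 0 \<le> x $ e) \<and> (\<forall>e. e \<notin> arcs D \<longrightarrow> x $ e = 0) \<and>
     (\<forall>w\<in>bverts D. incidence D w \<bullet> x = 1)"
  unfolding magic_polytope_def ball_Un Plus_def
  by (auto simp: inner_incidence_Inl inner_incidence_Inr)

lemma incidence_sum_component:
  assumes "finite C"
  shows "(\<Sum>w\<in>C. c w *\<^sub>R incidence D w) $ e =
    (if e \<in> arcs D then (if Inl (tail D e) \<in> C then c (Inl (tail D e)) else 0) +
       (if Inr (head D e) \<in> C then c (Inr (head D e)) else 0) else 0)"
proof (cases "e \<in> arcs D")
  case True
  have "(\<Sum>w\<in>C. c w *\<^sub>R incidence D w) $ e =
     (\<Sum>w\<in>C. (if w = Inl (tail D e) then c w else 0) + (if w = Inr (head D e) then c w else 0))"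
    unfolding sum_component by (rule sum.cong) (auto simp: incidence_def True)
  then show ?thesis using True assms by (simp add: sum.distrib sum.delta)
qed (simp add: incidence_def)

text \<open>No arc leaves \<open>C\<close>, so in the signed sum of the rows of \<open>C\<close>
  every arc contributes 1 - 1 or nothing. This relation is solved for the row of
  \<open>w0\<close>.\<close>

lemma incidence_in_span:
  assumes fin: "finite C" and w0: "w0 \<in> C"
    and closed: "\<And>e. e \<in> arcs D \<Longrightarrow> Inl (tail D e) \<in> C \<longleftrightarrow> Inr (head D e) \<in> C"
  shows "incidence D w0 \<in> span (incidence D ` (C - {w0}))"
proof -
  have "(\<Sum>w\<in>C. side_sign w *\<^sub>R incidence D w) = 0"
    unfolding vec_eq_iff incidence_sum_component[OF fin] using closed by auto
  then have "side_sign w0 *\<^sub>R incidence D w0 + (\<Sum>w\<in>C - {w0}. side_sign w *\<^sub>R incidence D w) = 0"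
    by (simp add: sum.remove[OF fin w0])
  then have "side_sign w0 *\<^sub>R incidence D w0 = - (\<Sum>w\<in>C - {w0}. side_sign w *\<^sub>R incidence D w)"
    by (simp add: eq_neg_iff_add_eq_0)
  also have "\<dots> \<in> span (incidence D ` (C - {w0}))"
    by (intro span_neg span_sum span_scale span_base) auto
  finally have "(1 / side_sign w0) *\<^sub>R side_sign w0 *\<^sub>R incidence D w0 \<in> span (incidence D ` (C - {w0}))"
    by (rule span_scale)
  then show ?thesis by simp
qed

text \<open>Rank-nullity: within the coordinate subspace of \<open>arcs D\<close>, which contains
  all rows, the kernel is the orthogonal complement of their span.\<close>

lemma dim_magic_kernel:
  fixes D :: "('v, 'e::finite) pre_digraph"
  shows "dim (magic_kernel D W) + dim (incidence D ` W) = card (arcs D)"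
proof -
  let ?B = "{x :: real ^ 'e. \<forall>e. e \<notin> arcs D \<longrightarrow> x $ e = 0}"
  let ?A = "span (incidence D ` W)"
  have sB: "subspace ?B" by (auto simp: subspace_def)
  have sub: "?A \<subseteq> ?B" by (rule span_minimal[OF _ sB]) (auto simp: incidence_def)
  have "magic_kernel D W = {y \<in> ?B. \<forall>x\<in>?A. orthogonal x y}"
  proof (intro set_eqI iffI)
    fix y assume y: "y \<in> magic_kernel D W"
    have "orthogonal y x" if "x \<in> ?A" for x
      by (rule orthogonal_to_span[OF that])
        (use y in \<open>auto simp: magic_kernel_def orthogonal_def inner_commute\<close>)
    with y show "y \<in> {y \<in> ?B. \<forall>x\<in>?A. orthogonal x y}"
      by (auto simp: magic_kernel_def orthogonal_commute)
  next
    fix y assume "y \<in> {y \<in> ?B. \<forall>x\<in>?A. orthogonal x y}"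
    then show "y \<in> magic_kernel D W"
      by (auto simp: magic_kernel_def orthogonal_def span_base)
  qed
  then show ?thesis
    using dim_subspace_orthogonal_to_vectors[OF subspace_span sB sub] dim_vec_supported[of "arcs D"]
    by simp
qed

section \<open>Connected components and the rank of the vertex equations\<close>

definition bip_conn :: "('v, 'e) pre_digraph \<Rightarrow> (('v + 'v) \<times> ('v + 'v)) set" where
  "bip_conn D = {(u, v). u \<in> bverts D \<and> v \<in> bverts D \<and>
     (u, v) \<in> {(x, y). {x, y} \<in> uedges (digraph_bipartite D)}\<^sup>*}"

lemma uedges_digraph_bipartite:
  "uedges (digraph_bipartite D) = (\<lambda>e. {Inl (tail D e), Inr (head D e)}) ` arcs D"
  by (force simp: digraph_bipartite_def arcs_ends_def arc_to_ends_def)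

lemma equiv_bip_conn: "equiv (bverts D) (bip_conn D)"
proof (rule equivI)
  have "sym {(x, y). {x, y} \<in> uedges (digraph_bipartite D)}"
    by (auto simp: sym_def insert_commute)
  from sym_rtrancl[OF this] show "sym (bip_conn D)"
    unfolding bip_conn_def by (intro symI) (blast dest: symD)
  show "trans (bip_conn D)"
    unfolding bip_conn_def trans_def by (auto intro: rtrancl_trans)
qed (auto simp: bip_conn_def refl_on_def)

lemma arc_in_bip_conn:
  assumes "wf_digraph D" "e \<in> arcs D"
  shows "(Inl (tail D e), Inr (head D e)) \<in> bip_conn D"
proof -
  interpret wf_digraph D by fact
  show ?thesis
    using assms(2) unfolding bip_conn_def uedges_digraph_bipartite
    by (auto intro!: r_into_rtrancl)
qed

text \<open>Splitting a component into its \<open>Inl\<close> and \<open>Inr\<close> vertices shows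
  it to be bipartite, so \<open>b\<close> counts all components.\<close>

lemma num_bipartite_components_digraph_bipartite:
  "num_bipartite_components (digraph_bipartite D) = card (bverts D // bip_conn D)"
proof -
  have comps: "connected_components_graph (digraph_bipartite D) = bverts D // bip_conn D"
    by (simp add: connected_components_graph_def bip_conn_def digraph_bipartite_def)
  have "bipartite_on (digraph_bipartite D) C" for C
    unfolding bipartite_on_def uedges_digraph_bipartite
    by (rule exI[of _ "C \<inter> range Inl"], rule exI[of _ "C \<inter> range Inr"])
      (auto simp: doubleton_eq_iff, metis rangeI sum.exhaust)
  then show ?thesis by (simp add: num_bipartite_components_def comps)
qed

text \<open>
  The incidence vectors with one representative per component removed form a basis of the span.
\<close>

lemma dim_incidence:
  assumes wf: "wf_digraph D" and fin: "finite (verts D)"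
  shows "dim (incidence D ` bverts D) + card (bverts D // bip_conn D) = 2 * card (verts D)"
proof -
  let ?R = "bip_conn D" and ?V = "bverts D"
  note eq = equiv_bip_conn[of D]
  have finV: "finite ?V" using fin by simp
  have finQ: "finite (?V // ?R)"
    by (rule finite_quotient[OF finV]) (auto simp: bip_conn_def)
  define rep where "rep C = (SOME w. w \<in> C)" for C :: "('a + 'a) set"
  have rep: "rep C \<in> C" if "C \<in> ?V // ?R" for C
    using in_quotient_imp_non_empty[OF eq that] unfolding rep_def by (simp add: some_in_eq)
  define T where "T = rep ` (?V // ?R)"
  define N where "N = ?V - T"
  have TV: "T \<subseteq> ?V" using rep in_quotient_imp_subset[OF eq] by (auto simp: T_def)
  have "inj_on rep (?V // ?R)"
    by (rule inj_onI) (metis rep quotient_disj[OF eq] disjoint_iff)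
  then have cardT: "card T = card (?V // ?R)" by (simp add: T_def card_image)
  have finN: "finite N" using finV by (simp add: N_def)
  have cardV: "card ?V = 2 * card (verts D)" using fin by (simp add: card_Plus)
  have cardN: "card N + card T = 2 * card (verts D)"
    using card_Diff_subset[OF finite_subset[OF TV finV] TV] card_mono[OF finV TV] cardV
    by (simp add: N_def)
  have scalars: "c w = 0" if c: "(\<Sum>w\<in>N. c w *\<^sub>R incidence D w) = 0" and w: "w \<in> N" for c w
  proof -
    \<comment> \<open>The signed coefficients, extended by 0 to the removed representatives. The
      relation at an arc says that \<open>g\<close> agrees at its two ends, so \<open>g\<close> is
      constant on components and equals its value 0 at the representative.\<close>
    define g where "g u = (if u \<in> N then side_sign u * c u else 0)" for u
    have g_arc: "g (Inl (tail D e)) = g (Inr (head D e))" if "e \<in> arcs D" for e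
      using arg_cong[OF c, of "\<lambda>x. x $ e"] that
      unfolding incidence_sum_component[OF finN] by (auto simp: g_def split: if_splits)
    have g_edge: "g x = g y" if "{x, y} \<in> uedges (digraph_bipartite D)" for x y
      using that g_arc unfolding uedges_digraph_bipartite by (auto simp: doubleton_eq_iff)
    have g_conn: "g x = g y" if "(x, y) \<in> bip_conn D" for x y
    proof -
      from that have "(x, y) \<in> {(x, y). {x, y} \<in> uedges (digraph_bipartite D)}\<^sup>*"
        by (simp add: bip_conn_def)
      then show ?thesis by induction (use g_edge in auto)
    qed
    have wV: "w \<in> ?V" using w by (simp add: N_def)
    let ?C = "?R `` {w}"
    have C: "?C \<in> ?V // ?R" by (rule quotientI[OF wV])
    have "(w, rep ?C) \<in> bip_conn D" using rep[OF C] by simp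
    then have "g w = g (rep ?C)" by (rule g_conn)
    moreover have "rep ?C \<notin> N" using C by (auto simp: N_def T_def)
    ultimately show "c w = 0" using w by (simp add: g_def)
  qed
  have ind: "inj_on (incidence D) N" "independent (incidence D ` N)"
    by (rule indexed_independent[OF finN]; blast intro: scalars)+
  have "incidence D w \<in> span (incidence D ` N)" if w: "w \<in> ?V" for w
  proof (cases "w \<in> T")
    case True
    then obtain C where C: "C \<in> ?V // ?R" and wC: "w = rep C" by (auto simp: T_def)
    have CV: "C \<subseteq> ?V" by (rule in_quotient_imp_subset[OF eq C])
    have closed: "Inl (tail D e) \<in> C \<longleftrightarrow> Inr (head D e) \<in> C" if "e \<in> arcs D" for e
      using arc_in_bip_conn[OF wf that] in_quotient_imp_closed[OF eq C]
        eq by (meson equivE symE)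
    have "incidence D w \<in> span (incidence D ` (C - {w}))"
      using finite_subset[OF CV finV] rep[OF C] closed wC by (intro incidence_in_span) auto
    \<comment> \<open>Distinct components are disjoint, so \<open>w\<close> is the only
      representative in \<open>C\<close>.\<close>
    moreover have "C - {w} \<subseteq> N"
    proof
      fix u assume u: "u \<in> C - {w}"
      have "u \<notin> T"
      proof
        assume "u \<in> T"
        then obtain C' where "C' \<in> ?V // ?R" "u = rep C'" by (auto simp: T_def)
        with u C rep[of C'] quotient_disj[OF eq C, of C'] wC show False by auto
      qed
      with u CV show "u \<in> N" by (auto simp: N_def)
    qed
    ultimately show ?thesis using span_mono[OF image_mono] by blast
  next
    case False
    with w show ?thesis by (auto simp: N_def intro: span_base)
  qed
  then have "incidence D ` ?V \<subseteq> span (incidence D ` N)" by blast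
  then have "dim (incidence D ` ?V) = card (incidence D ` N)"
    using ind(2) by (intro dim_unique[of "incidence D ` N"]) (auto simp: N_def)
  also have "\<dots> = card N" by (rule card_image[OF ind(1)])
  finally show ?thesis using cardN cardT by simp
qed

section \<open>Perturbation, dimension and boundedness\<close>

text \<open>Kernel directions preserve the equations, and only coordinates with slack move, so a
  small step in either direction keeps all labels nonnegative. Dimension, integrality and the
  description of faces all rest on this.\<close>

lemma magic_polytope_perturb:
  fixes D :: "('v, 'e::finite) pre_digraph"
  assumes x: "x \<in> magic_polytope D" and y: "y \<in> magic_kernel D (bverts D)"
    and pos: "\<And>e. y $ e \<noteq> 0 \<Longrightarrow> 0 < x $ e"
  shows "\<exists>\<epsilon>>0. \<forall>t. \<bar>t\<bar> \<le> \<epsilon> \<longrightarrow> x + t *\<^sub>R y \<in> magic_polytope D"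
proof -
  \<comment> \<open>The admissible step length at each coordinate. The value 1 where
    \<open>y\<close> vanishes keeps the minimum over all coordinates positive.\<close>
  define m where "m e = (if y $ e = 0 then 1 else x $ e / \<bar>y $ e\<bar>)" for e
  define \<epsilon> where "\<epsilon> = Min (range m)"
  have "\<epsilon> > 0" unfolding \<epsilon>_def using pos by (subst Min_gr_iff) (auto simp: m_def)
  moreover have "x + t *\<^sub>R y \<in> magic_polytope D" if t: "\<bar>t\<bar> \<le> \<epsilon>" for t
  proof -
    have "0 \<le> x $ e + t * y $ e" for e
    proof (cases "y $ e = 0")
      case True
      with x show ?thesis by (simp add: mem_magic_polytope)
    next
      case False
      have "\<bar>t\<bar> \<le> m e" using t unfolding \<epsilon>_def by (rule order_trans) simp
      with False have "\<bar>t * y $ e\<bar> \<le> x $ e" by (simp add: m_def field_simps abs_mult)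
      then show ?thesis by linarith
    qed
    then show ?thesis using x y
      by (auto simp: mem_magic_polytope magic_kernel_def inner_add_right)
  qed
  ultimately show ?thesis by blast
qed

lemma diff_in_magic_kernel:
  "x \<in> magic_polytope D \<Longrightarrow> y \<in> magic_polytope D \<Longrightarrow> x - y \<in> magic_kernel D (bverts D)"
  by (auto simp: mem_magic_polytope magic_kernel_def inner_diff_right)

text \<open>Translated by \<open>-x\<close>, the polytope lies in the kernel and spans it: as
  \<open>x\<close> is positive on all arcs, a small multiple of any kernel vector stays inside. The
  kernel has dimension \<open>card (arcs D)\<close> minus the rank.\<close>

lemma aff_dim_magic_polytope:
  fixes D :: "('v, 'e::finite) pre_digraph"
  assumes wf: "wf_digraph D" and fin: "finite (verts D)"
    and x: "x \<in> magic_polytope D" and pos: "\<And>e. e \<in> arcs D \<Longrightarrow> 0 < x $ e"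
  shows "aff_dim (magic_polytope D) =
    int (card (arcs D)) - 2 * int (card (verts D)) + int (num_bipartite_components (digraph_bipartite D))"
proof -
  let ?P = "magic_polytope D" and ?K = "magic_kernel D (bverts D)"
  let ?Q = "(+) (- x) ` ?P"
  have "0 \<in> ?Q" using x by force
  then have "aff_dim ?P = int (dim ?Q)"
    using aff_dim_zero[of ?Q] aff_dim_translation_eq[of "- x" ?P] by (metis hull_inc)
  moreover have "dim ?Q = dim ?K"
  proof (rule antisym)
    have "?Q \<subseteq> ?K" using diff_in_magic_kernel[OF _ x] by auto
    then show "dim ?Q \<le> dim ?K" by (rule dim_subset)
    have "?K \<subseteq> span ?Q"
    proof
      fix y assume y: "y \<in> ?K"
      then have "0 < x $ e" if "y $ e \<noteq> 0" for e using that pos by (auto simp: magic_kernel_def)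
      from magic_polytope_perturb[OF x y this] obtain \<epsilon>
        where eps: "\<epsilon> > 0" "x + \<epsilon> *\<^sub>R y \<in> ?P" by (metis abs_of_pos order_refl)
      then have "\<epsilon> *\<^sub>R y \<in> ?Q" by force
      then have "\<epsilon> *\<^sub>R y \<in> span ?Q" by (rule span_base)
      then have "(1 / \<epsilon>) *\<^sub>R \<epsilon> *\<^sub>R y \<in> span ?Q" by (rule span_scale)
      with eps(1) show "y \<in> span ?Q" by simp
    qed
    then show "dim ?K \<le> dim ?Q" by (metis dim_span dim_subset)
  qed
  ultimately show ?thesis
    using dim_magic_kernel[of D "bverts D"] dim_incidence[OF wf fin]
    by (simp add: num_bipartite_components_digraph_bipartite)
qed

text \<open>Finitely many half-spaces and hyperplanes cut out a polyhedron. It is bounded because a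
  label is at most the sum 1 at the tail of its arc.\<close>

lemma polytope_magic_polytope:
  fixes D :: "('v, 'e::finite) pre_digraph"
  assumes wf: "wf_digraph D" and fin: "finite (verts D)"
  shows "polytope (magic_polytope D)"
proof -
  interpret wf_digraph D by fact
  let ?P = "magic_polytope D"
  let ?H = "range (\<lambda>e. {x :: real ^ 'e. axis e 1 \<bullet> x \<ge> 0}) \<union>
    (\<lambda>e. {x. axis e 1 \<bullet> x = 0}) ` (- arcs D) \<union> (\<lambda>w. {x. incidence D w \<bullet> x = 1}) ` bverts D"
  have "?P = \<Inter> ?H"
    by (simp add: set_eq_iff mem_magic_polytope inner_axis' ball_Un Inter_Un_distrib) blast
  moreover have "polyhedron (\<Inter> ?H)"
    using fin by (intro polyhedron_Inter)
      (auto intro: polyhedron_halfspace_ge polyhedron_hyperplane)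
  moreover have "?P \<subseteq> cbox 0 1"
  proof
    fix x assume x: "x \<in> ?P"
    have "x $ e \<le> 1" for e
    proof (cases "e \<in> arcs D")
      case True
      then have "x $ e \<le> (\<Sum>e\<in>out_arcs D (tail D e). x $ e)"
        using x by (intro member_le_sum) (auto simp: mem_magic_polytope out_arcs_def)
      also have "\<dots> = 1" using x True by (auto simp: magic_polytope_def)
      finally show ?thesis .
    qed (use x in \<open>simp add: mem_magic_polytope\<close>)
    with x show "x \<in> cbox 0 1" by (simp add: mem_box_cart mem_magic_polytope)
  qed
  then have "bounded ?P" by (rule bounded_subset[OF bounded_cbox])
  ultimately show ?thesis by (simp add: polytope_eq_bounded_polyhedron)
qed

section \<open>Integrality of the extreme points\<close>

lemma not_Ints_partner:
  fixes x :: "'e \<Rightarrow> real"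
  assumes "finite A" "sum x A \<in> \<int>" "e \<in> A" "x e \<notin> \<int>"
  shows "\<exists>e'\<in>A. e' \<noteq> e \<and> x e' \<notin> \<int>"
proof (rule ccontr)
  assume "\<not> ?thesis"
  then have "sum x (A - {e}) \<in> \<int>" by (intro Ints_sum) auto
  then have "sum x A - sum x (A - {e}) \<in> \<int>" using assms(2) by (intro Ints_diff)
  with assms show False by (simp add: sum.remove)
qed

text \<open>Unknowns are counted against equations on the arcs with non-integral label.\<close>

lemma extreme_point_integral:
  fixes D :: "('v, 'e::finite) pre_digraph"
  assumes wf: "wf_digraph D" and x: "x extreme_point_of magic_polytope D"
  shows "x $ i \<in> \<int>"
proof (rule ccontr)
  interpret wf_digraph D by fact
  assume i: "x $ i \<notin> \<int>"
  have xP: "x \<in> magic_polytope D" using x by (simp add: extreme_point_of_def)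
  define F where "F = {e. x $ e \<notin> \<int>}"
  have F: "F \<subseteq> arcs D" using xP by (force simp: F_def mem_magic_polytope)
  have F_pos: "0 < x $ e" if "e \<in> F" for e
  proof -
    have "x $ e \<noteq> 0" using that by (auto simp: F_def)
    moreover have "0 \<le> x $ e" using xP by (simp add: mem_magic_polytope)
    ultimately show ?thesis by simp
  qed
  \<comment> \<open>Deleting the arcs with integral label makes \<open>card F\<close> the number of
    unknowns in \<open>dim_magic_kernel\<close>. \<open>W\<close> below collects the vertex copies
    that meet \<open>F\<close>.\<close>
  define H where "H = D\<lparr>arcs := F\<rparr>"
  have H: "arcs H = F" "tail H = tail D" "head H = head D" by (simp_all add: H_def)
  define W where "W = Inl ` tail D ` F \<union> Inr ` head D ` F"
  have "2 * card (tail D ` F) \<le> card F"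
  proof (rule card_image_two_to_one)
    fix e assume e: "e \<in> F"
    have "(\<Sum>e\<in>out_arcs D (tail D e). x $ e) = 1"
      using xP e F by (auto simp: magic_polytope_def)
    then show "\<exists>e'\<in>F. e' \<noteq> e \<and> tail D e' = tail D e"
      using not_Ints_partner[of "out_arcs D (tail D e)" "($) x" e] e F
      by (auto simp: F_def out_arcs_def)
  qed simp
  moreover have "2 * card (head D ` F) \<le> card F"
  proof (rule card_image_two_to_one)
    fix e assume e: "e \<in> F"
    have "(\<Sum>e\<in>in_arcs D (head D e). x $ e) = 1"
      using xP e F by (auto simp: magic_polytope_def)
    then show "\<exists>e'\<in>F. e' \<noteq> e \<and> head D e' = head D e"
      using not_Ints_partner[of "in_arcs D (head D e)" "($) x" e] e F
      by (auto simp: F_def in_arcs_def)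
  qed simp
  moreover have "card W \<le> card (tail D ` F) + card (head D ` F)"
    unfolding W_def by (rule order_trans[OF card_Un_le]) (simp add: card_image)
  ultimately have card_W: "card W \<le> card F" by linarith
  have finW: "finite W" by (simp add: W_def)
  define w0 where "w0 = (Inl (tail D i) :: 'v + 'v)"
  have w0: "w0 \<in> W" using i by (auto simp: w0_def W_def F_def)
  \<comment> \<open>\<open>W\<close> contains both ends of every arc of \<open>H\<close>, so one row
    is redundant. This makes the rank strictly smaller than \<open>card W\<close>, hence than
    \<open>card F\<close>.\<close>
  have "incidence H w0 \<in> span (incidence H ` (W - {w0}))"
    by (rule incidence_in_span[OF finW w0]) (auto simp: H W_def)
  then have "incidence H ` W \<subseteq> span (incidence H ` (W - {w0}))"
    by (auto intro: span_base)
  then have "dim (incidence H ` W) \<le> card (incidence H ` (W - {w0}))"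
    by (rule dim_le_card) (simp add: finW)
  also have "\<dots> \<le> card (W - {w0})" by (rule card_image_le) (simp add: finW)
  also have "\<dots> < card W" by (rule psubset_card_mono[OF finW]) (use w0 in auto)
  finally have "dim (magic_kernel H W) \<noteq> 0"
    using dim_magic_kernel[of H W, unfolded H(1)] card_W by linarith
  then obtain y where y: "y \<in> magic_kernel H W" "y \<noteq> 0" by auto
  have y_supp: "y $ e = 0" if "e \<notin> F" for e using y(1) that by (simp add: magic_kernel_def H)
  have "y \<in> magic_kernel D (bverts D)"
  proof -
    \<comment> \<open>Copies outside \<open>W\<close> meet no arc of \<open>H\<close>, so their
      equations hold trivially for a vector supported on \<open>F\<close>.\<close>
    have "incidence D w \<bullet> y = 0" for w
    proof -
      have "incidence D w \<bullet> y = incidence H w \<bullet> y"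
        unfolding inner_vec_def using F y_supp
        by (intro sum.cong) (auto simp: incidence_def H)
      also have "\<dots> = 0"
      proof (cases "w \<in> W")
        case False
        then have "incidence H w = 0" by (auto simp: incidence_def H W_def vec_eq_iff)
        then show ?thesis by simp
      qed (use y in \<open>simp add: magic_kernel_def\<close>)
      finally show ?thesis .
    qed
    with y_supp F show ?thesis by (auto simp: magic_kernel_def)
  qed
  from magic_polytope_perturb[OF xP this] y_supp F_pos
  obtain \<epsilon> where eps: "\<epsilon> > 0" "\<And>t. \<bar>t\<bar> \<le> \<epsilon> \<Longrightarrow> x + t *\<^sub>R y \<in> magic_polytope D" by metis
  \<comment> \<open>\<open>x\<close> is the midpoint of the two opposite perturbations.\<close>
  have "x \<in> open_segment (x + (-\<epsilon>) *\<^sub>R y) (x + \<epsilon> *\<^sub>R y)"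
    unfolding in_segment
  proof (intro conjI exI[of _ "1/2"])
    show "x + (-\<epsilon>) *\<^sub>R y \<noteq> x + \<epsilon> *\<^sub>R y" using eps(1) y(2) by (auto simp: neg_eq_iff_add_eq_0 simp flip: scaleR_add_left)
    show "x = (1 - 1/2) *\<^sub>R (x + (-\<epsilon>) *\<^sub>R y) + (1/2) *\<^sub>R (x + \<epsilon> *\<^sub>R y)"
      by (simp add: vec_eq_iff field_simps)
  qed simp_all
  moreover have "x + (-\<epsilon>) *\<^sub>R y \<in> magic_polytope D" "x + \<epsilon> *\<^sub>R y \<in> magic_polytope D"
    using eps(1) by (auto intro!: eps(2) simp del: scaleR_minus_left)
  ultimately show False using x by (auto simp: extreme_point_of_def)
qed

section \<open>Positivity and points of the polytope\<close>

text \<open>The average of one witness per coordinate is positive at all of them, since no witness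
  has a negative coordinate.\<close>

lemma convex_positive_point:
  fixes C :: "(real ^ 'e::finite) set"
  assumes "convex C" "C \<noteq> {}" and nonneg: "\<And>x e. x \<in> C \<Longrightarrow> 0 \<le> x $ e"
    and pos: "\<And>e. e \<in> A \<Longrightarrow> \<exists>x\<in>C. 0 < x $ e"
  shows "\<exists>x\<in>C. \<forall>e\<in>A. 0 < x $ e"
proof (cases "A = {}")
  case False
  have finA: "finite A" by simp
  from pos obtain p where p: "\<And>e. e \<in> A \<Longrightarrow> p e \<in> C" "\<And>e. e \<in> A \<Longrightarrow> 0 < p e $ e" by metis
  let ?x = "\<Sum>e\<in>A. (1 / card A) *\<^sub>R p e"
  have "?x \<in> C"
    by (rule convex_sum[OF finA assms(1)]) (use False finA p in auto)
  moreover have "0 < ?x $ e" if e: "e \<in> A" for e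
    unfolding sum_component
    by (rule sum_pos2[OF finA e]) (use e False finA p nonneg in \<open>auto simp: card_gt_0_iff\<close>)
  ultimately show ?thesis by blast
qed (use assms in auto)

text \<open>Without parallel arcs, arcs correspond bijectively to edges of the bipartite graph. This
  translates edge labelings into vectors.\<close>

lemma sum_bipartite_edges:
  fixes D :: "('v, 'e::finite) pre_digraph" and L :: "('v + 'v) set \<Rightarrow> nat"
  assumes "nomulti_digraph D"
  shows "real (\<Sum>e\<in>{e \<in> uedges (digraph_bipartite D). w \<in> e}. L e) =
    incidence D w \<bullet> (\<chi> e. if e \<in> arcs D then real (L {Inl (tail D e), Inr (head D e)}) else 0)"
proof -
  interpret nomulti_digraph D by fact
  let ?edge = "\<lambda>e. {Inl (tail D e), Inr (head D e)} :: ('v + 'v) set"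
  let ?A = "{e \<in> arcs D. w \<in> ?edge e}"
  have inj: "inj_on ?edge ?A"
    by (rule inj_onI) (auto simp: doubleton_eq_iff arc_to_ends_def intro!: no_multi_arcs)
  have "{e \<in> uedges (digraph_bipartite D). w \<in> e} = ?edge ` ?A"
    by (auto simp: uedges_digraph_bipartite)
  then have "real (\<Sum>e\<in>{e \<in> uedges (digraph_bipartite D). w \<in> e}. L e) = (\<Sum>e\<in>?A. real (L (?edge e)))"
    by (simp only: of_nat_sum sum.reindex[OF inj] o_def)
  also have "\<dots> = incidence D w \<bullet> (\<chi> e. if e \<in> arcs D then real (L (?edge e)) else 0)"
    unfolding inner_vec_def
    by (rule sum.mono_neutral_cong_left) (auto simp: incidence_def)
  finally show ?thesis .
qed

text \<open>A magic labeling of sum \<open>r\<close> divided by \<open>r\<close> is a point of the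
  polytope.\<close>

lemma positive_digraph_imp_point:
  fixes D :: "('v, 'e::finite) pre_digraph"
  assumes nm: "nomulti_digraph D" and pos: "positive_digraph D" and e: "e \<in> arcs D"
  shows "\<exists>x\<in>magic_polytope D. 0 < x $ e"
proof -
  interpret nomulti_digraph D by fact
  let ?edge = "\<lambda>e. {Inl (tail D e), Inr (head D e)} :: ('v + 'v) set"
  have "?edge e \<in> uedges (digraph_bipartite D)" using e by (auto simp: uedges_digraph_bipartite)
  with pos obtain r L where L: "magic_labeling_graph (digraph_bipartite D) r L" "0 < L (?edge e)"
    unfolding positive_digraph_def positive_graph_def by blast
  define y where "y = (\<chi> e. if e \<in> arcs D then real (L (?edge e)) else 0)"
  have y: "incidence D w \<bullet> y = real r" if "w \<in> bverts D" for w
    using L(1) that unfolding y_def sum_bipartite_edges[OF nm, symmetric] magic_labeling_graph_def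
    by (simp add: digraph_bipartite_def)
  \<comment> \<open>The sum at the tail dominates the positive label of \<open>e\<close>, so
    \<open>r\<close> is nonzero and may be divided by.\<close>
  have "y $ e \<le> (\<Sum>e\<in>out_arcs D (tail D e). y $ e)"
    using e by (intro member_le_sum) (auto simp: y_def out_arcs_def)
  also have "\<dots> = real r" using y[OF InlI[OF tail_in_verts[OF e]]] by (simp add: inner_incidence_Inl)
  finally have r: "0 < r" using L(2) e by (auto simp: y_def)
  have "(1 / real r) *\<^sub>R y \<in> magic_polytope D"
    using r y by (auto simp: mem_magic_polytope y_def)
  moreover have "0 < ((1 / real r) *\<^sub>R y) $ e" using r L(2) e by (simp add: y_def)
  ultimately show ?thesis by blast
qed

text \<open>Integral points of the polytope are magic labelings of sum 1.\<close>

lemma positive_digraphI: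
  fixes D :: "('v, 'e::finite) pre_digraph"
  assumes nm: "nomulti_digraph D"
    and pts: "\<And>e. e \<in> arcs D \<Longrightarrow> \<exists>x\<in>magic_polytope D. (\<forall>i. x $ i \<in> \<int>) \<and> 0 < x $ e"
  shows "positive_digraph D"
  unfolding positive_digraph_def positive_graph_def
proof
  interpret nomulti_digraph D by fact
  let ?edge = "\<lambda>e. {Inl (tail D e), Inr (head D e)} :: ('v + 'v) set"
  fix d assume "d \<in> uedges (digraph_bipartite D)"
  then obtain e where e: "e \<in> arcs D" "d = ?edge e" by (auto simp: uedges_digraph_bipartite)
  from pts[OF e(1)] obtain x where x: "x \<in> magic_polytope D" "\<And>i. x $ i \<in> \<int>" "0 < x $ e" by blast
  have inj: "inj_on ?edge (arcs D)"
    by (rule inj_onI) (auto simp: doubleton_eq_iff arc_to_ends_def intro!: no_multi_arcs)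
  \<comment> \<open>\<open>inv_into\<close> recovers the arc from its edge; rounding loses nothing
    at nonnegative integers.\<close>
  define L where "L = (\<lambda>d. nat \<lfloor>x $ inv_into (arcs D) ?edge d\<rfloor>)"
  have L: "real (L (?edge e)) = x $ e" if "e \<in> arcs D" for e
    using that x(1) x(2)[of e]
    by (auto simp: L_def inv_into_f_f[OF inj] mem_magic_polytope elim: Ints_cases)
  have eq: "(\<chi> e. if e \<in> arcs D then real (L (?edge e)) else 0) = x"
    using x(1) L by (auto simp: vec_eq_iff mem_magic_polytope)
  have "(\<Sum>e\<in>{e \<in> uedges (digraph_bipartite D). w \<in> e}. L e) = 1" if "w \<in> bverts D" for w
  proof -
    have "real (\<Sum>e\<in>{e \<in> uedges (digraph_bipartite D). w \<in> e}. L e) = 1"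
      unfolding sum_bipartite_edges[OF nm] eq using x(1) that by (simp add: mem_magic_polytope)
    then show ?thesis by linarith
  qed
  moreover have "uverts (digraph_bipartite D) = bverts D" by (simp add: digraph_bipartite_def)
  ultimately have "magic_labeling_graph (digraph_bipartite D) 1 L"
    by (simp add: magic_labeling_graph_def)
  moreover have "0 < L d" using L[OF e(1)] x(3) e(2) by simp
  ultimately show "\<exists>r L. magic_labeling_graph (digraph_bipartite D) r L \<and> 0 < L d" by blast
qed

section \<open>Faces and subdigraphs\<close>

lemma magic_polytope_subdigraph:
  fixes D D' :: "('v, 'e::finite) pre_digraph"
  assumes "arcs D' \<subseteq> arcs D" "verts D' = verts D" "tail D' = tail D" "head D' = head D"
  shows "magic_polytope D' = {x \<in> magic_polytope D. \<forall>e. e \<notin> arcs D' \<longrightarrow> x $ e = 0}"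
proof -
  have "incidence D w \<bullet> x = incidence D' w \<bullet> x" if "\<forall>e. e \<notin> arcs D' \<longrightarrow> x $ e = 0" for w x
    unfolding inner_vec_def using that assms
    by (intro sum.cong) (auto simp: incidence_def)
  moreover have "e \<notin> arcs D'" if "e \<notin> arcs D" for e using assms(1) that by blast
  ultimately show ?thesis using assms(2-4) by (auto simp: mem_magic_polytope)
qed

text \<open>The total label outside \<open>D'\<close> is nonnegative on the polytope and vanishes
  exactly on that of \<open>D'\<close>, which gives a supporting hyperplane. The face may be empty
  here.\<close>

lemma magic_polytope_subdigraph_face:
  fixes D D' :: "('v, 'e::finite) pre_digraph"
  assumes wf: "wf_digraph D" and fin: "finite (verts D)"
    and sub: "arcs D' \<subseteq> arcs D" "verts D' = verts D" "tail D' = tail D" "head D' = head D"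
  shows "magic_polytope D' face_of magic_polytope D"
proof -
  let ?P = "magic_polytope D" and ?a = "\<Sum>e\<in>- arcs D'. axis e (1::real)"
  have inner: "?a \<bullet> x = (\<Sum>e\<in>- arcs D'. x $ e)" for x
    by (simp add: inner_sum_left inner_axis')
  have "magic_polytope D' = ?P \<inter> {x. ?a \<bullet> x = 0}"
    unfolding magic_polytope_subdigraph[OF sub] inner
    by (auto simp: mem_magic_polytope sum_nonneg_eq_0_iff)
  also have "\<dots> face_of ?P"
    by (rule face_of_Int_supporting_hyperplane_ge)
      (auto simp: inner mem_magic_polytope intro: sum_nonneg polytope_imp_convex polytope_magic_polytope[OF wf fin])
  finally show ?thesis .
qed

text \<open>The segment from \<open>z\<close> to \<open>x\<close> can be prolonged beyond
  \<open>x\<close> inside the polytope, because \<open>x\<close> is positive wherever it differs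
  from \<open>z\<close>. A face with \<open>x\<close> strictly inside this segment contains its
  endpoint \<open>z\<close>.\<close>

lemma magic_polytope_face_support:
  fixes D :: "('v, 'e::finite) pre_digraph"
  assumes F: "F face_of magic_polytope D" and x: "x \<in> F"
    and supp: "\<And>e. e \<in> A \<Longrightarrow> 0 < x $ e" and z: "z \<in> magic_polytope D" "\<And>e. e \<notin> A \<Longrightarrow> z $ e = 0"
    and x0: "\<And>e. e \<notin> A \<Longrightarrow> x $ e = 0"
  shows "z \<in> F"
proof (cases "z = x")
  case False
  have xP: "x \<in> magic_polytope D" using F x face_of_imp_subset by blast
  have "0 < x $ e" if "(x - z) $ e \<noteq> 0" for e using that supp z(2) x0 by (cases "e \<in> A") auto
  from magic_polytope_perturb[OF xP diff_in_magic_kernel[OF xP z(1)] this]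
  obtain \<epsilon> where eps: "\<epsilon> > 0" "x + \<epsilon> *\<^sub>R (x - z) \<in> magic_polytope D"
    by (metis abs_of_pos order_refl)
  have "x \<in> open_segment z (x + \<epsilon> *\<^sub>R (x - z))"
    unfolding in_segment
  proof (intro conjI exI[of _ "1 / (1 + \<epsilon>)"])
    have "x + \<epsilon> *\<^sub>R (x - z) - z = (1 + \<epsilon>) *\<^sub>R (x - z)" by (simp add: algebra_simps)
    with eps(1) False show "z \<noteq> x + \<epsilon> *\<^sub>R (x - z)" by auto
    have "(1 - 1 / (1 + \<epsilon>)) *\<^sub>R z + (1 / (1 + \<epsilon>)) *\<^sub>R (x + \<epsilon> *\<^sub>R (x - z)) =
        z + (1 / (1 + \<epsilon>) * (1 + \<epsilon>)) *\<^sub>R (x - z)"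
      by (simp add: scaleR_left_diff_distrib scaleR_left_distrib scaleR_right_distrib
          scaleR_right_diff_distrib distrib_left)
    also have "\<dots> = x" using eps(1) by simp
    finally show "x = (1 - 1 / (1 + \<epsilon>)) *\<^sub>R z + (1 / (1 + \<epsilon>)) *\<^sub>R (x + \<epsilon> *\<^sub>R (x - z))" ..
  qed (use eps(1) in auto)
  with F x z(1) eps(2) show ?thesis unfolding face_of_def by blast
qed (use x in simp)

text \<open>Removing arcs refines the connectivity relation, so the number of classes cannot
  drop.\<close>

lemma num_bipartite_components_mono:
  assumes sub: "arcs D' \<subseteq> arcs D" "verts D' = verts D" "tail D' = tail D" "head D' = head D"
    and fin: "finite (verts D)"
  shows "num_bipartite_components (digraph_bipartite D) \<le> num_bipartite_components (digraph_bipartite D')"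
proof -
  have "uedges (digraph_bipartite D') \<subseteq> uedges (digraph_bipartite D)"
    using sub by (auto simp: uedges_digraph_bipartite)
  then have "{(x, y). {x, y} \<in> uedges (digraph_bipartite D')}\<^sup>* \<subseteq>
      {(x, y). {x, y} \<in> uedges (digraph_bipartite D)}\<^sup>*"
    by (intro rtrancl_mono) auto
  then have "bip_conn D' \<subseteq> bip_conn D" using sub by (auto simp: bip_conn_def)
  moreover have "finite (bverts D // bip_conn D')"
    using fin sub(2) by (intro finite_quotient) (auto simp: bip_conn_def)
  ultimately show ?thesis
    using finite_refines_card_le[of "bverts D" "bip_conn D'" "bip_conn D"]
      equiv_bip_conn[of D] equiv_bip_conn[of D'] sub(2)
    by (simp add: num_bipartite_components_digraph_bipartite)
qed

text \<open>The digraph \<open>D'\<close> keeps the arcs that are positive somewhere on the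
  face.\<close>

lemma magic_polytope_face_eq:
  fixes D :: "('v, 'e::finite) pre_digraph"
  assumes nm: "nomulti_digraph D" and fin: "finite (verts D)"
    and F: "F face_of magic_polytope D" "F \<noteq> {}"
  obtains D' where "spanning D' D" "positive_digraph D'" "F = magic_polytope D'"
    "int (card (arcs D')) \<le> 2 * int (card (verts D)) -
      int (num_bipartite_components (digraph_bipartite D)) + aff_dim F"
proof -
  interpret nomulti_digraph D by fact
  note wf = wf_digraph_axioms
  note poly = polytope_magic_polytope[OF wf fin]
  have FP: "F \<subseteq> magic_polytope D" by (rule face_of_imp_subset[OF F(1)])
  define A where "A = {e. \<exists>x\<in>F. 0 < x $ e}"
  have zero: "x $ e = 0" if "x \<in> F" "e \<notin> A" for x e
  proof -
    have "0 \<le> x $ e" using that(1) FP by (auto simp: mem_magic_polytope)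
    with that show ?thesis by (force simp: A_def)
  qed
  have AD: "A \<subseteq> arcs D" using FP by (force simp: A_def mem_magic_polytope)
  define D' where "D' = D\<lparr>arcs := A\<rparr>"
  have D': "arcs D' = A" "verts D' = verts D" "tail D' = tail D" "head D' = head D"
    by (simp_all add: D'_def)
  have sub: "arcs D' \<subseteq> arcs D" using AD D' by simp
  have nm': "nomulti_digraph D'"
    by unfold_locales (use AD in \<open>auto simp: D' arc_to_ends_def intro!: no_multi_arcs\<close>)
  then interpret D': nomulti_digraph D' .
  note wf' = D'.wf_digraph_axioms
  have convF: "convex F" by (rule face_of_imp_convex[OF F(1)])
  have compF: "compact F"
    using poly F(1) by (blast intro: face_of_imp_compact polytope_imp_compact polytope_imp_convex)
  \<comment> \<open>A single point positive on the whole support serves both the inclusion of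
    \<open>magic_polytope D'\<close> in \<open>F\<close> and the dimension formula for
    \<open>D'\<close>.\<close>
  obtain x where x: "x \<in> F" "\<And>e. e \<in> A \<Longrightarrow> 0 < x $ e"
    using convex_positive_point[OF convF F(2), of A] FP by (force simp: A_def mem_magic_polytope)
  have F_eq: "F = magic_polytope D'"
  proof
    show "F \<subseteq> magic_polytope D'"
      using FP zero by (auto simp: magic_polytope_subdigraph[OF sub D'(2-4)] D')
    show "magic_polytope D' \<subseteq> F"
    proof
      fix z assume "z \<in> magic_polytope D'"
      then have "z \<in> magic_polytope D" "\<And>e. e \<notin> A \<Longrightarrow> z $ e = 0"
        by (auto simp: magic_polytope_subdigraph[OF sub D'(2-4)] D')
      with magic_polytope_face_support[OF F(1) x(1), of A z] x zero show "z \<in> F" by blast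
    qed
  qed
  have pos: "positive_digraph D'"
  proof (rule positive_digraphI[OF nm'])
    fix e assume "e \<in> arcs D'"
    then have e: "e \<in> A" by (simp add: D')
    \<comment> \<open>Otherwise all extreme points, and with them their convex hull
      \<open>F\<close>, would have nonpositive coordinate \<open>e\<close>, unlike
      \<open>x\<close>.\<close>
    have "\<exists>p. p extreme_point_of F \<and> 0 < p $ e"
    proof (rule ccontr)
      assume no: "\<not> ?thesis"
      have "{p. p extreme_point_of F} \<subseteq> {p. axis e 1 \<bullet> p \<le> 0}"
        using no by (auto simp: inner_axis' not_less)
      then have "convex hull {p. p extreme_point_of F} \<subseteq> {p. axis e 1 \<bullet> p \<le> 0}"
        by (rule hull_minimal) (rule convex_halfspace_le)
      with Krein_Milman_Minkowski[OF compF convF] x e show False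
        by (force simp: inner_axis')
    qed
    then obtain p where p: "p extreme_point_of F" "0 < p $ e" by blast
    \<comment> \<open>Extreme points of a face are extreme in the whole polytope, hence
      integral.\<close>
    then have "\<forall>i. p $ i \<in> \<int>" using extreme_point_integral[OF wf] extreme_point_of_face[OF F(1)] by blast
    with p F_eq show "\<exists>x\<in>magic_polytope D'. (\<forall>i. x $ i \<in> \<int>) \<and> 0 < x $ e"
      by (auto simp: extreme_point_of_def)
  qed
  have "spanning D' D"
    using wf wf' sub D' by (simp add: spanning_def subgraph_def compatible_def)
  \<comment> \<open>The dimension formula is an equality with the components of \<open>D'\<close>;
    replacing their number by the smaller one for \<open>D\<close> yields the bound on the
    arcs.\<close>
  moreover have "aff_dim F = int (card (arcs D')) - 2 * int (card (verts D)) +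
      int (num_bipartite_components (digraph_bipartite D'))"
    using aff_dim_magic_polytope[OF wf', of x] fin x F_eq by (simp add: D')
  then have "int (card (arcs D')) \<le> 2 * int (card (verts D)) -
      int (num_bipartite_components (digraph_bipartite D)) + aff_dim F"
    using num_bipartite_components_mono[OF sub D'(2-4) fin] by linarith
  ultimately show thesis using that pos F_eq by blast
qed

theorem theorem1p5p5:
  fixes D :: "('v, 'e::finite) pre_digraph" and q n b :: nat
  assumes "fin_digraph D" and "nomulti_digraph D"
    and "positive_digraph D"
    and "arcs D \<noteq> {}"
    and "q = card (arcs D)"
    and "n = card (verts D)"
    and "b = num_bipartite_components (digraph_bipartite D)"
  shows "integral_polytope (magic_polytope D) \<and>
    aff_dim (magic_polytope D) = int q - 2 * int n + int b \<and>
    (\<forall>d::nat.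
      {F. F \<noteq> {} \<and> F face_of magic_polytope D \<and> aff_dim F = int d} =
      {magic_polytope D' | D'. spanning D' D \<and> positive_digraph D' \<and>
         int (card (arcs D')) \<le> 2 * int n - int b + int d \<and>
         aff_dim (magic_polytope D') = int d})"
proof (intro conjI allI)
  interpret fin_digraph D by fact
  note wf = wf_digraph_axioms and fin = finite_verts
  let ?P = "magic_polytope D"
  have poly: "polytope ?P" by (rule polytope_magic_polytope[OF wf fin])
  then show "integral_polytope ?P"
    using extreme_point_integral[OF wf] by (auto simp: integral_polytope_def)
  note pts = positive_digraph_imp_point[OF assms(2,3)]
  have "\<exists>x\<in>?P. \<forall>e\<in>arcs D. 0 < x $ e"
  proof (rule convex_positive_point)
    show "convex ?P" using poly by (rule polytope_imp_convex)
    show "?P \<noteq> {}" using assms(4) pts by blast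
  qed (use pts in \<open>auto simp: mem_magic_polytope\<close>)
  then obtain x where "x \<in> ?P" "\<And>e. e \<in> arcs D \<Longrightarrow> 0 < x $ e" by blast
  from aff_dim_magic_polytope[OF wf fin this] show "aff_dim ?P = int q - 2 * int n + int b"
    by (simp only: assms(5-7))
  fix d :: nat
  show "{F. F \<noteq> {} \<and> F face_of ?P \<and> aff_dim F = int d} =
      {magic_polytope D' | D'. spanning D' D \<and> positive_digraph D' \<and>
         int (card (arcs D')) \<le> 2 * int n - int b + int d \<and>
         aff_dim (magic_polytope D') = int d}" (is "?L = ?R")
  proof
    show "?L \<subseteq> ?R"
    proof
      fix F assume "F \<in> ?L"
      then have F: "F \<noteq> {}" "F face_of ?P" "aff_dim F = int d" by auto
      from magic_polytope_face_eq[OF assms(2) fin F(2,1)]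
      obtain D' where "spanning D' D" "positive_digraph D'" "F = magic_polytope D'"
        "int (card (arcs D')) \<le> 2 * int n - int b + aff_dim F"
        unfolding assms(6,7) by blast
      with F(3) show "F \<in> ?R" by auto
    qed
    show "?R \<subseteq> ?L"
    proof
      fix F assume "F \<in> ?R"
      then obtain D' where D': "F = magic_polytope D'" "spanning D' D" "aff_dim F = int d" by auto
      then have "F face_of ?P"
        using magic_polytope_subdigraph_face[OF wf fin, of D']
        by (simp add: spanning_def subgraph_def compatible_def)
      \<comment> \<open>The empty set has affine dimension -1, which is not a natural
        number.\<close>
      moreover have "F \<noteq> {}" using D'(3) by auto
      ultimately show "F \<in> ?L" using D'(3) by simp
    qed
  qed
qed

end
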